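(* Let $\Sigma\in S_{2d}^{++}(\mathbb{R})$ be a positive-definite covariance matrix on $\mathbb{R}^d\times\mathbb{R}^d$ and denote by $\Gamma_{12}$ the $d\times d$ upper-right block of its inverse $\Sigma^{-1}$. Suppose that $\varepsilon$ is a random variable over $\mathbb{R}_+$ whose distribution is absolutely continuous with respect to Lebesgue measure. Then $M_\varepsilon=I_d-\varepsilon\Gamma_{12}$ is almost surely invertible.
   Context: $S_{2d}^{++}(\mathbb{R})$ is the set of real symmetric positive-definite $2d\times 2d$ matrices. *)

theory Defs
  imports "HOL-Probability.Probability"
begin

text \<open>
  With \<open>'n\<close> an index type of \<open>d\<close> elements, \<open>'n + 'n\<close> indexes \<open>\<real>\<^sup>d \<times> \<real>\<^sup>d\<close>:
  \<open>Inl\<close> is the first copy of \<open>\<real>\<^sup>d\<close> and \<open>Inr\<close> the second.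
\<close>

definition sym_pos_def :: "(real ^ 'm ^ 'm) set"
  where "sym_pos_def = {A. transpose A = A \<and> (\<forall>x. x \<noteq> 0 \<longrightarrow> x \<bullet> (A *v x) > 0)}"

definition upper_right_block :: "real ^ ('n + 'n) ^ ('n + 'n) \<Rightarrow> real ^ 'n ^ 'n"
  where "upper_right_block A = (\<chi> i j. A $ Inl i $ Inr j)"

end

theory Submission
  imports Defs
begin

text \<open>
  For a square matrix \<open>G\<close>, the function \<open>t \<mapsto> det (I - t G)\<close> is a polynomial in \<open>t\<close> with value \<open>1\<close>
  at \<open>t = 0\<close>. Hence it is not the zero polynomial, and \<open>I - t G\<close> is singular for only finitely many
  \<open>t\<close>. A finite set is Lebesgue null, so a random variable whose law is absolutely continuous
  avoids it almost surely. Take \<open>G\<close> to be the upper-right block of \<open>\<Sigma>\<^sup>-\<^sup>1\<close>.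
\<close>

text \<open>
  Evaluation at a point is a ring homomorphism from polynomials to the coefficient ring, and the
  Leibniz formula for the determinant uses only ring operations.
\<close>

lemma poly_det:
  fixes A :: "'a::comm_ring_1 poly ^ 'n::finite ^ 'n"
  shows "poly (det A) t = det (\<chi> i j. poly (A $ i $ j) t)"
  by (simp add: det_def poly_sum poly_prod)

lemma finite_singular_pencil:
  fixes G :: "real ^ 'n::finite ^ 'n"
  shows "finite {t. \<not> invertible (mat 1 - t *\<^sub>R G)}"
proof -
  define P where "P = det (\<chi> i j. [:(mat 1 :: real ^ 'n ^ 'n) $ i $ j, - G $ i $ j:])"
  have eval: "poly P t = det (mat 1 - t *\<^sub>R G)" for t
    unfolding P_def poly_det by (rule arg_cong[where f = det]) (simp add: vec_eq_iff)
  have "poly P 0 = 1"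
    by (simp add: eval)
  then have "P \<noteq> 0"
    by auto
  then have "finite {t. poly P t = 0}"
    by (rule poly_roots_finite)
  then show ?thesis
    by (simp add: eval invertible_det_nz)
qed

lemma AE_not_in_null_set_of_absolutely_continuous_distr:
  assumes "X \<in> measurable M N"
    and "absolutely_continuous L (distr M N X)"
    and "Z \<in> null_sets L"
  shows "AE \<omega> in M. X \<omega> \<notin> Z"
proof -
  have "Z \<in> null_sets (distr M N X)"
    using assms(2,3) by (auto simp: absolutely_continuous_def)
  then have "AE x in distr M N X. x \<notin> Z"
    by (rule AE_not_in)
  with assms(1) show ?thesis
    by (rule AE_distrD)
qed

theorem lemma4p1:
  fixes \<Sigma> :: "real ^ ('n::finite + 'n) ^ ('n + 'n)"
    and M :: "'a measure"
    and \<epsilon> :: "'a \<Rightarrow> real"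
  assumes "\<Sigma> \<in> sym_pos_def"
    and "prob_space M"
    and "\<epsilon> \<in> borel_measurable M"
    and "\<And>\<omega>. \<omega> \<in> space M \<Longrightarrow> 0 \<le> \<epsilon> \<omega>"
    and "absolutely_continuous lborel (distr M borel \<epsilon>)"
  shows "AE \<omega> in M. invertible (mat 1 - \<epsilon> \<omega> *\<^sub>R upper_right_block (matrix_inv \<Sigma>))"
proof -
  let ?Z = "{t. \<not> invertible (mat 1 - t *\<^sub>R upper_right_block (matrix_inv \<Sigma>))}"
  have "?Z \<in> null_sets lborel"
    by (rule finite_imp_null_set_lborel[OF finite_singular_pencil])
  with assms(3,5) have "AE \<omega> in M. \<epsilon> \<omega> \<notin> ?Z"
    by (rule AE_not_in_null_set_of_absolutely_continuous_distr)
  then show ?thesis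
    by simp
qed

end
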